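(* Let $k\geq 3$. There is no $k$-geodetic digraph with minimum out-degree at least $2$ and order $M(2,k)+2$ (where $M(2,k)=1+2+\dots+2^k$) whose in-degree sequence is $(1,2,\dots,2,3)$, i.e. exactly one vertex has in-degree $1$, exactly one has in-degree $3$, and all others have in-degree $2$.
   Context: A digraph is $k$-geodetic if for any two vertices $u,v$ there is at most one directed walk from $u$ to $v$ of length at most $k$. The in-degree sequence is the list of in-degrees of the vertices in non-decreasing order. *)

theory Defs
  imports "Graph_Theory.Graph_Theory" "HOL-Library.Multiset"
begin

(* Walks are arc lists, and u = v and the empty walk are allowed. For k \<ge> 1 the property
   therefore excludes loops (a loop and the empty walk both join u to u) as well as
   parallel arcs, so simplicity of the digraph need not be assumed separately. *)
definition k_geodetic :: "nat \<Rightarrow> ('a, 'b) pre_digraph \<Rightarrow> bool" where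
  "k_geodetic k G \<longleftrightarrow>
     (\<forall>u\<in>verts G. \<forall>v\<in>verts G. \<forall>p q.
        pre_digraph.awalk G u p v \<and> length p \<le> k \<and>
        pre_digraph.awalk G u q v \<and> length q \<le> k \<longrightarrow> p = q)"

(* Only meaningful for finite, nonempty vertex sets. *)
definition min_out_degree :: "('a, 'b) pre_digraph \<Rightarrow> nat" where
  "min_out_degree G = Min (out_degree G ` verts G)"

definition in_degree_sequence :: "('a, 'b) pre_digraph \<Rightarrow> nat list" where
  "in_degree_sequence G = sorted_list_of_multiset (image_mset (in_degree G) (mset_set (verts G)))"

definition moore_bound :: "nat \<Rightarrow> nat \<Rightarrow> nat" where
  "moore_bound d k = (\<Sum>i\<le>k. d ^ i)"

end

theory Submission
  imports Defs
begin

text \<open>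
  Let \<open>w\<close> be the vertex of in-degree 3. By \<open>k\<close>-geodecity the walks of length at most \<open>k\<close> ending
  in \<open>w\<close> have distinct initial vertices, so the sets of vertices at distance \<open>0, 1, \<dots>, k\<close> to \<open>w\<close>
  form a tree. Its layers have sizes \<open>1, 3\<close>, and from then on each layer at least doubles,
  except that the unique vertex of in-degree 1 may once cost one vertex. Hence layer \<open>j \<ge> 2\<close> has
  at least \<open>5 * 2^(j-2)\<close> vertices, and the tree has at least \<open>5 * 2^(k-1) - 1\<close> vertices,
  which exceeds \<open>M(2,k) + 2 = 2^(k+1) + 1\<close> as soon as \<open>k \<ge> 3\<close>.
\<close>

text \<open>Walks of length exactly \<open>j\<close> stand in for distance \<open>j\<close>. In a
  \<open>k\<close>-geodetic digraph the two agree for \<open>j\<close> up to \<open>k\<close>, since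
  a shorter walk would be a second short walk between the same vertices.\<close>

definition in_layer :: "('a, 'b) pre_digraph \<Rightarrow> 'a \<Rightarrow> nat \<Rightarrow> 'a set" where
  "in_layer G w j = {v. \<exists>p. pre_digraph.awalk G v p w \<and> length p = j}"

context fin_digraph
begin

lemma in_layer_subset_verts: "in_layer G w j \<subseteq> verts G"
  by (auto simp: in_layer_def awalk_def)

lemma finite_in_layer: "finite (in_layer G w j)"
  using in_layer_subset_verts finite_verts by (rule finite_subset)

lemma in_layer_0: "w \<in> verts G \<Longrightarrow> in_layer G w 0 = {w}"
  by (auto simp: in_layer_def awalk_def)

lemma in_layer_Suc: "in_layer G w (Suc j) = tail G ` (\<Union>v\<in>in_layer G w j. in_arcs G v)"
proof (intro equalityI subsetI)
  fix u assume "u \<in> in_layer G w (Suc j)"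
  then obtain e p where "awalk u (e # p) w" "length p = j"
    by (auto simp: in_layer_def length_Suc_conv)
  then show "u \<in> tail G ` (\<Union>v\<in>in_layer G w j. in_arcs G v)"
    by (auto simp: in_layer_def awalk_Cons_iff intro!: image_eqI[where x = e])
next
  fix u assume "u \<in> tail G ` (\<Union>v\<in>in_layer G w j. in_arcs G v)"
  then obtain e p where "e \<in> arcs G" "u = tail G e" "awalk (head G e) p w" "length p = j"
    by (auto simp: in_layer_def)
  then have "awalk u (e # p) w \<and> length (e # p) = Suc j"
    by (simp add: awalk_Cons_iff)
  then show "u \<in> in_layer G w (Suc j)"
    unfolding in_layer_def by blast
qed

lemma k_geodeticD:
  assumes "k_geodetic k G" "awalk u p v" "awalk u q v" "length p \<le> k" "length q \<le> k"
  shows "p = q"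
  using assms awalk_hd_in_verts awalk_last_in_verts unfolding k_geodetic_def by blast

text \<open>Two arcs with a common tail entering the layer would start two different walks of length
  \<open>Suc j\<close> from that tail to \<open>w\<close>, so no tail is counted twice.\<close>

lemma card_in_layer_Suc:
  assumes "k_geodetic k G" "Suc j \<le> k"
  shows "card (in_layer G w (Suc j)) = (\<Sum>v\<in>in_layer G w j. in_degree G v)"
proof -
  have "inj_on (tail G) (\<Union>v\<in>in_layer G w j. in_arcs G v)"
  proof (rule inj_onI)
    fix e f
    assume "e \<in> (\<Union>v\<in>in_layer G w j. in_arcs G v)" "f \<in> (\<Union>v\<in>in_layer G w j. in_arcs G v)"
      and tails: "tail G e = tail G f"
    then obtain p q where "e \<in> arcs G" "awalk (head G e) p w" "length p = j"
      and "f \<in> arcs G" "awalk (head G f) q w" "length q = j"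
      by (auto simp: in_layer_def)
    then have "e # p = f # q"
      using assms tails by (intro k_geodeticD[of k "tail G e" _ w]) (auto simp: awalk_Cons_iff)
    then show "e = f" by simp
  qed
  then have "card (in_layer G w (Suc j)) = card (\<Union>v\<in>in_layer G w j. in_arcs G v)"
    by (simp add: in_layer_Suc card_image)
  also have "\<dots> = (\<Sum>v\<in>in_layer G w j. card (in_arcs G v))"
    by (rule card_UN_disjoint) (auto simp: finite_in_layer)
  finally show ?thesis by (simp add: in_degree_def)
qed

lemma in_layer_disjoint:
  assumes "k_geodetic k G" "i \<le> k" "j \<le> k" "i \<noteq> j"
  shows "in_layer G w i \<inter> in_layer G w j = {}"
  using assms by (auto simp: in_layer_def dest: k_geodeticD)

lemma sum_card_in_layer_le:
  assumes "k_geodetic k G"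
  shows "(\<Sum>j\<le>k. card (in_layer G w j)) \<le> card (verts G)"
proof -
  have "(\<Sum>j\<le>k. card (in_layer G w j)) = card (\<Union>j\<le>k. in_layer G w j)"
    using assms
    by (intro card_UN_disjoint[symmetric]) (auto simp: finite_in_layer dest: in_layer_disjoint)
  also have "\<dots> \<le> card (verts G)"
    using in_layer_subset_verts by (intro card_mono) auto
  finally show ?thesis .
qed

text \<open>The sum counts the layers that contain \<open>z\<close>, and layers up to index
  \<open>k\<close> are disjoint. Hence the deficient vertex costs a vertex at most once.\<close>

lemma sum_of_bool_in_layer_le:
  assumes "k_geodetic k G" "i \<le> Suc k"
  shows "(\<Sum>j<i. of_bool (z \<in> in_layer G w j)) \<le> (1::nat)"
proof -
  have "j = j'" if "j < i" "z \<in> in_layer G w j" "j' < i" "z \<in> in_layer G w j'" for j j'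
    using in_layer_disjoint[OF assms(1), of j j' w] assms(2) that by fastforce
  then have "card ({..<i} \<inter> {j. z \<in> in_layer G w j}) \<le> 1"
    by (auto simp: card_le_Suc0_iff_eq)
  then show ?thesis by (simp add: of_bool_def sum.If_cases)
qed

lemma two_card_in_layer_le:
  assumes "k_geodetic k G" "Suc j \<le> k"
    and "in_degree G z \<ge> 1" "\<And>v. v \<in> verts G \<Longrightarrow> v \<noteq> z \<Longrightarrow> in_degree G v \<ge> 2"
  shows "2 * card (in_layer G w j) \<le> card (in_layer G w (Suc j)) + of_bool (z \<in> in_layer G w j)"
proof -
  have "2 * card (in_layer G w j) = (\<Sum>v\<in>in_layer G w j. 2)"
    by simp
  also have "\<dots> \<le> (\<Sum>v\<in>in_layer G w j. in_degree G v + of_bool (v = z))"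
  proof (rule sum_mono)
    fix v assume "v \<in> in_layer G w j"
    then have "v \<in> verts G" using in_layer_subset_verts by blast
    then show "2 \<le> in_degree G v + of_bool (v = z)"
      using assms(3) assms(4)[of v] by (cases "v = z") auto
  qed
  also have "\<dots> = card (in_layer G w (Suc j)) + of_bool (z \<in> in_layer G w j)"
    using assms by (simp add: sum.distrib card_in_layer_Suc of_bool_def finite_in_layer)
  finally show ?thesis .
qed

text \<open>The bound is strengthened for the induction: the spare 1 is the loss still allowed, and
  the sum records whether \<open>z\<close> has already used it up in an earlier layer.\<close>

lemma card_in_layer_ge:
  assumes geo: "k_geodetic k G" and "i + 2 \<le> k"
    and w: "w \<in> verts G" "in_degree G w = 3"
    and z: "in_degree G z \<ge> 1" "\<And>v. v \<in> verts G \<Longrightarrow> v \<noteq> z \<Longrightarrow> in_degree G v \<ge> 2"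
  shows "5 * 2 ^ i + 1 \<le> card (in_layer G w (i + 2)) + (\<Sum>j<i + 2. of_bool (z \<in> in_layer G w j))"
  using \<open>i + 2 \<le> k\<close>
proof (induction i)
  case 0
  \<comment> \<open>Doubling 3 gives 6 = 5 + 1, less one if \<open>z\<close> lies in layer
    1.\<close>
  then have "card (in_layer G w 1) = 3"
    using card_in_layer_Suc[OF geo, of 0 w] w by (simp add: in_layer_0)
  with 0 show ?case
    using two_card_in_layer_le[OF geo _ z, of 1 w] by (simp add: numeral_2_eq_2)
next
  case (Suc i)
  have "2 * card (in_layer G w (i + 2))
      \<le> card (in_layer G w (Suc i + 2)) + of_bool (z \<in> in_layer G w (i + 2))"
    using two_card_in_layer_le[OF geo _ z, of "i + 2" w] Suc.prems by simp
  \<comment> \<open>With s for this sum, doubling the hypothesis turns 1 - s into 2 - 2s, which is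
    at least 1 - s precisely because s is at most 1.\<close>
  moreover have "(\<Sum>j<i + 2. of_bool (z \<in> in_layer G w j)) \<le> (1::nat)"
    using Suc.prems by (intro sum_of_bool_in_layer_le[OF geo]) simp
  moreover have "(\<Sum>j<Suc i + 2. of_bool (z \<in> in_layer G w j))
      = (\<Sum>j<i + 2. of_bool (z \<in> in_layer G w j)) + (of_bool (z \<in> in_layer G w (i + 2)) :: nat)"
    by (simp del: sum_of_bool_eq)
  ultimately show ?case
    using Suc.IH Suc.prems unfolding power_Suc by linarith
qed

text \<open>The bounds for layers 2 to \<open>m + 1\<close> form a geometric sum with value
  \<open>5 * 2 ^ m - 5\<close>; layers 0 and 1 add 4.\<close>

lemma card_verts_ge:
  assumes geo: "k_geodetic (m + 1) G"
    and w: "w \<in> verts G" "in_degree G w = 3"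
    and z: "in_degree G z \<ge> 1" "\<And>v. v \<in> verts G \<Longrightarrow> v \<noteq> z \<Longrightarrow> in_degree G v \<ge> 2"
  shows "5 * 2 ^ m \<le> card (verts G) + 1"
proof -
  have layer_1: "card (in_layer G w 1) = 3"
    using card_in_layer_Suc[OF geo, of 0 w] w by (simp add: in_layer_0)
  have layer: "5 * 2 ^ i \<le> card (in_layer G w (i + 2))" if "i < m" for i
    using card_in_layer_ge[OF geo _ w z, of i] sum_of_bool_in_layer_le[OF geo, of "i + 2" z w] that
    by simp
  have "(2::nat) ^ m = (\<Sum>i<m. 2 ^ i) + 1"
    by (induction m) auto
  then have "5 * 2 ^ m = 5 * (\<Sum>i<m. 2 ^ i) + (5::nat)"
    by simp
  also have "5 * (\<Sum>i<m. 2 ^ i) = (\<Sum>i<m. 5 * 2 ^ i :: nat)"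
    by (rule sum_distrib_left)
  also have "\<dots> \<le> (\<Sum>i<m. card (in_layer G w (i + 2)))"
    using layer by (intro sum_mono) simp
  finally have "5 * 2 ^ m \<le> (\<Sum>i<m. card (in_layer G w (i + 2))) + 5"
    by simp
  \<comment> \<open>The 5 splits as 1 + 3 for layers 0 and 1, plus the 1 that remains.\<close>
  also have "(\<Sum>i<m. card (in_layer G w (i + 2))) + 5
      = (\<Sum>j<Suc (Suc m). card (in_layer G w j)) + 1"
    using layer_1 w by (simp only: sum.lessThan_Suc_shift) (simp add: in_layer_0)
  also have "\<dots> \<le> card (verts G) + 1"
    using sum_card_in_layer_le[OF geo, of w] by (simp add: lessThan_Suc_atMost)
  finally show ?thesis .
qed

end

lemma in_degree_sequence_1_2_3:
  assumes "finite (verts G)" "in_degree_sequence G = 1 # replicate n 2 @ [3]"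
  obtains z w where "w \<in> verts G" "in_degree G w = 3" "in_degree G z = 1"
    "\<And>v. v \<in> verts G \<Longrightarrow> v \<noteq> z \<Longrightarrow> in_degree G v \<ge> 2"
proof -
  let ?M = "image_mset (in_degree G) (mset_set (verts G))"
  have "mset (in_degree_sequence G) = ?M"
    by (simp add: in_degree_sequence_def)
  then have M: "?M = {#1, 3#} + replicate_mset n 2"
    using assms(2) by (simp add: add_mset_commute)
  have "set_mset ?M = in_degree G ` verts G"
    using assms(1) by simp
  then have img: "in_degree G ` verts G = {1, 3} \<union> (if n = 0 then {} else {2})"
    unfolding M by auto
  then obtain w z where w: "w \<in> verts G" "in_degree G w = 3"
    and z: "z \<in> verts G" "in_degree G z = 1"
    by (metis (no_types, lifting) Un_iff imageE insertCI)
  \<comment> \<open>The entry 1 has multiplicity one, so \<open>z\<close> is the only vertex with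
    in-degree below 2.\<close>
  have "card {v \<in> verts G. in_degree G v = 1} = count ?M 1"
    using assms(1) by (simp add: count_image_mset_eq_card_vimage)
  also have "\<dots> = 1" unfolding M by simp
  finally have "{v \<in> verts G. in_degree G v = 1} = {z}"
    using z by (metis (mono_tags, lifting) card_1_singletonE mem_Collect_eq singletonD)
  moreover have "in_degree G v \<in> {1, 2, 3}" if "v \<in> verts G" for v
    using img that by (auto split: if_splits)
  ultimately have "in_degree G v \<ge> 2" if "v \<in> verts G" "v \<noteq> z" for v
    using that by fastforce
  with w z show ?thesis by (intro that)
qed

lemma moore_bound_2: "moore_bound 2 k + 1 = 2 ^ (k + 1)"
  unfolding moore_bound_def by (induction k) auto

theorem theorem4:
  fixes k :: nat
  assumes "k \<ge> 3"
  shows "\<not> (\<exists>G :: ('a, 'b) pre_digraph.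
           fin_digraph G \<and> k_geodetic k G \<and> min_out_degree G \<ge> 2 \<and>
           card (verts G) = moore_bound 2 k + 2 \<and>
           in_degree_sequence G = 1 # replicate (card (verts G) - 2) 2 @ [3])"
proof
  assume "\<exists>G :: ('a, 'b) pre_digraph.
           fin_digraph G \<and> k_geodetic k G \<and> min_out_degree G \<ge> 2 \<and>
           card (verts G) = moore_bound 2 k + 2 \<and>
           in_degree_sequence G = 1 # replicate (card (verts G) - 2) 2 @ [3]"
  then obtain G :: "('a, 'b) pre_digraph" where "fin_digraph G" and geo: "k_geodetic k G"
    and order: "card (verts G) = moore_bound 2 k + 2"
    and seq: "in_degree_sequence G = 1 # replicate (card (verts G) - 2) 2 @ [3]"
    by blast
  interpret fin_digraph G by fact
  obtain z w where w: "w \<in> verts G" "in_degree G w = 3" and z: "in_degree G z = 1"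
    "\<And>v. v \<in> verts G \<Longrightarrow> v \<noteq> z \<Longrightarrow> in_degree G v \<ge> 2"
    using in_degree_sequence_1_2_3[OF finite_verts seq] by metis
  obtain m where k: "k = m + 1" and "m \<ge> 2"
    using assms by (metis Suc_eq_plus1 Suc_le_D Suc_le_mono numeral_3_eq_3 numeral_2_eq_2)
  have "5 * 2 ^ m \<le> card (verts G) + 1"
    using card_verts_ge[of m w z] geo k w z by simp
  also have "\<dots> = 4 * 2 ^ m + 2"
    using order moore_bound_2[of k] k by simp
  \<comment> \<open>For \<open>m = 1\<close>, that is \<open>k = 2\<close>, this inequality would
    still hold; \<open>m \<ge> 2\<close> is what refutes it.\<close>
  finally have "(2::nat) ^ m \<le> 2" by simp
  moreover have "(2::nat) ^ 2 \<le> 2 ^ m"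
    using \<open>m \<ge> 2\<close> by (intro power_increasing) auto
  ultimately show False by simp
qed

end
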